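(* There are sets of $n$ points in $\mathbb{R}^3$ for which the number of unit-volume tetrahedra determined by the $n$ points is $\Omega(n^3\log\log n)$.
   Context: A tetrahedron determined by a finite set $S\subset\mathbb{R}^3$ is a tetrahedron whose four vertices are points of $S$. It is unit-volume if its volume is $1$. The constant hidden in $\Omega(\cdot)$ is absolute, and the bound is asserted for all sufficiently large $n$. *)

theory Defs
  imports "HOL-Analysis.Analysis" "HOL-Library.Landau_Symbols"
begin

definition tetrahedra :: "(real ^ 3) set \<Rightarrow> (real ^ 3) set set" where
  "tetrahedra S =
     {convex hull V | V. V \<subseteq> S \<and> card V = 4 \<and> \<not> affine_dependent V}"

definition unit_volume_tetrahedra :: "(real ^ 3) set \<Rightarrow> (real ^ 3) set set" where
  "unit_volume_tetrahedra S = {T \<in> tetrahedra S. measure lebesgue T = 1}"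

end

theory Submission
  imports Defs "HOL-Number_Theory.Totient" "HOL-Real_Asymp.Real_Asymp"
begin

text \<open>
  An integer grid of width \<open>3b\<close> and height \<open>2a\<close>, with \<open>a! \<le> b\<close>, contains of the order of
  \<open>(ab)\<^sup>2 ln a\<close> triangles of area \<open>a!/2\<close> (Erdos and Purdy): for coprime \<open>t < v\<close> and \<open>dv \<le> a\<close>,
  \<open>mv \<le> b\<close>, the edge vectors \<open>(mv, dv)\<close> and \<open>(mt - a!/(dv), dt)\<close> have determinant \<open>a!\<close>, so there
  are about \<open>ab \<Sum> \<phi>(v)/v\<^sup>2\<close> choices of edge vectors at each grid point. Multiplying the sum by
  \<open>\<Sum> 1/k\<^sup>2\<close> and using \<open>\<Sum>\<^sub>d\<^sub>|\<^sub>n \<phi>(d) = n\<close> bounds it below by the harmonic number. Putting a linear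
  number of apexes in a parallel plane at the right height gives \<open>n\<^sup>3 ln a\<close> unit tetrahedra, and
  \<open>a\<close> may be taken as large as the square root of \<open>ln n\<close>.
\<close>

section \<open>Arithmetic estimates: the totient sum and integer division\<close>

lemma sum_inverse_squares_le: "(\<Sum>k=1..n. 1 / real k ^ 2) \<le> 2"
proof -
  \<comment> \<open>The term \<open>- 1 / real n\<close> makes the induction work:
    \<open>1/(n+1)^2 <= 1/n - 1/(n+1)\<close> telescopes.\<close>
  have "(\<Sum>k=1..n. 1 / real k ^ 2) \<le> 2 - 1 / real n" if "n \<ge> 1" for n
    using that
  proof (induction n rule: dec_induct)
    case (step n)
    have "1 / real (Suc n) ^ 2 \<le> 1 / real n - 1 / real (Suc n)"
      using step.hyps by (simp add: divide_simps power2_eq_square)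
    with step.IH show ?case by simp
  qed simp
  from this[of n] show ?thesis
    by (cases "n \<ge> 1") (auto intro: order_trans)
qed

lemma sum_totient_over_square_ge:
  "(\<Sum>v=1..a. real (totient v) / real v ^ 2) \<ge> ln (real a + 1) / 2"
proof -
  let ?S = "SIGMA n:{1..a}. {d. d dvd n}"
  let ?s = "\<Sum>v=1..a. real (totient v) / real v ^ 2"
  have "ln (real a + 1) \<le> harm a"
    by (rule harm_ge_ln)
  \<comment> \<open>Each \<open>1/n\<close> is read as \<open>n/n^2\<close>, and the numerator is
    expanded by the divisor sum of the totient.\<close>
  also have "harm a = (\<Sum>n=1..a. \<Sum>d | d dvd n. real (totient d) / real n ^ 2)"
    unfolding harm_def
  proof (rule sum.cong)
    fix n assume "n \<in> {1..a}"
    have "(\<Sum>d | d dvd n. real (totient d) / real n ^ 2) = real n / real n ^ 2"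
      by (simp add: totient_divisor_sum flip: sum_divide_distrib of_nat_sum)
    thus "inverse (of_nat n) = (\<Sum>d | d dvd n. real (totient d) / real n ^ 2)"
      using \<open>n \<in> _\<close> by (simp add: field_simps power2_eq_square)
  qed simp
  also have "\<dots> = (\<Sum>(n, d)\<in>?S. real (totient d) / real n ^ 2)"
    by (rule sum.Sigma) auto
  \<comment> \<open>A pair \<open>(n, d)\<close> with \<open>d dvd n\<close> corresponds to
    \<open>(v, k) = (d, n/d)\<close>, so that \<open>n = v * k\<close>. Dropping the constraint
    \<open>v * k <= a\<close> only adds nonnegative terms, and the double sum then factors.\<close>
  also have "\<dots> \<le> (\<Sum>(v, k)\<in>{1..a} \<times> {1..a}. real (totient v) / real v ^ 2 * (1 / real k ^ 2))"
  proof (rule sum_le_included[where i = "\<lambda>(v, k). (v * k, v)"])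
    show "finite ?S" by (intro finite_SigmaI) auto
    show "\<forall>p\<in>?S. \<exists>q\<in>{1..a} \<times> {1..a}. (case q of (v, k) \<Rightarrow> (v * k, v)) = p \<and>
        (case p of (n, d) \<Rightarrow> real (totient d) / real n ^ 2)
        \<le> (case q of (v, k) \<Rightarrow> real (totient v) / real v ^ 2 * (1 / real k ^ 2))"
    proof
      fix p assume "p \<in> ?S"
      then obtain d k where p: "p = (d * k, d)" "1 \<le> d * k" "d * k \<le> a"
        by (auto elim!: dvdE)
      hence "d > 0" "k > 0" by (auto intro: Nat.gr0I)
      moreover from this have "d \<le> d * k" "k \<le> d * k" by simp_all
      hence "d \<le> a" "k \<le> a" using p(3) by linarith+
      ultimately have "(d, k) \<in> {1..a} \<times> {1..a}" by simp
      thus "\<exists>q\<in>{1..a} \<times> {1..a}. (case q of (v, k) \<Rightarrow> (v * k, v)) = p \<and>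
        (case p of (n, d) \<Rightarrow> real (totient d) / real n ^ 2)
        \<le> (case q of (v, k) \<Rightarrow> real (totient v) / real v ^ 2 * (1 / real k ^ 2))"
        by (intro bexI[of _ "(d, k)"]) (auto simp: p power_mult_distrib)
    qed
  qed auto
  also have "\<dots> = ?s * (\<Sum>k=1..a. 1 / real k ^ 2)"
    by (simp add: sum_product sum.cartesian_product)
  also have "\<dots> \<le> ?s * 2"
    by (intro mult_left_mono sum_inverse_squares_le sum_nonneg) auto
  finally show ?thesis by simp
qed

text \<open>The quotient is at least 1, so the remainder is smaller than
  \<open>v * (b div v)\<close>: rounding down loses at most a factor 2.\<close>

lemma half_le_of_nat_div:
  assumes "1 \<le> v" "v \<le> b"
  shows "real b / (2 * real v) \<le> real (b div v)"
proof -
  have "1 \<le> b div v" using assms by (simp add: Suc_le_eq div_greater_zero_iff)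
  moreover have "b = b div v * v + b mod v" by simp
  moreover have "b mod v < v" using assms by simp
  ultimately have "b \<le> 2 * (b div v * v)"
    by (smt (verit, best) add_mono_thms_linordered_semiring(2) le_add1 less_or_eq_imp_le mult_2 mult_le_mono1 nat_mult_1 order_trans)
  hence "real b \<le> 2 * (real (b div v) * real v)"
    by (metis of_nat_le_iff of_nat_mult of_nat_numeral)
  thus ?thesis using assms by (simp add: field_simps)
qed

section \<open>Vertex sets and volumes of simplices\<close>

text \<open>Sorting the image under \<open>f\<close> recovers the listing order from the unordered
  set, so each vertex of a tetrahedron can be identified by its rank.\<close>

lemma insert4_eq_imp_eq:
  fixes f :: "'a \<Rightarrow> 'b::linorder"
  assumes "{a, b, c, d} = {a', b', c', d'}"
    and "f a < f b" "f b < f c" "f c < f d"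
    and "f a' < f b'" "f b' < f c'" "f c' < f d'"
  shows "a = a'" "b = b'" "c = c'" "d = d'"
proof -
  have *: "sorted_list_of_set (f ` {p, q, r, s}) = [f p, f q, f r, f s]"
    if "f p < f q" "f q < f r" "f r < f s" for p q r s
  proof -
    have "sorted_list_of_set (set [f p, f q, f r, f s]) = [f p, f q, f r, f s]"
      by (rule sorted_list_of_set.idem_if_sorted_distinct) (use that in auto)
    thus ?thesis by (simp only: list.set image_insert image_empty)
  qed
  have eq: "[f a, f b, f c, f d] = [f a', f b', f c', f d']"
    using *[OF assms(2-4)] *[OF assms(5-7)] unfolding assms(1) by (rule trans[OF sym])
  have inj: "inj_on f {a, b, c, d}"
    using assms(2-4) by (auto simp: inj_on_def)
  have "a' \<in> {a, b, c, d}" "b' \<in> {a, b, c, d}" "c' \<in> {a, b, c, d}" "d' \<in> {a, b, c, d}"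
    using assms(1) by auto
  thus "a = a'" "b = b'" "c = c'" "d = d'"
    using eq by (simp_all add: inj_on_eq_iff[OF inj])
qed

text \<open>The vertices of a simplex are exactly its extreme points. Counting tetrahedra as solids
  thus reduces to counting vertex sets.\<close>

lemma convex_hull_eq_imp_eq_affine_independent:
  fixes V W :: "'a::euclidean_space set"
  assumes "\<not> affine_dependent V" "\<not> affine_dependent W" "convex hull V = convex hull W"
  shows "V = W"
  using extreme_point_of_convex_hull_affine_independent[OF assms(1)]
    extreme_point_of_convex_hull_affine_independent[OF assms(2)] assms(3) by auto

text \<open>The hull lies in a proper affine subspace. Used contrapositively: positive volume yields
  affine independence.\<close>

lemma measure_convex_hull_affine_dependent:
  fixes V :: "'a::euclidean_space set"
  assumes "affine_dependent V" "card V = Suc DIM('a)"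
  shows "measure lebesgue (convex hull V) = 0"
proof -
  have "finite V" using assms(2) card.infinite by fastforce
  have "aff_dim V \<noteq> int (card V) - 1"
    using affine_independent_iff_card[of V] assms(1) \<open>finite V\<close> by auto
  hence "aff_dim V \<noteq> DIM('a)" using assms(2) by simp
  hence "affine hull (convex hull V) \<noteq> UNIV"
    by (metis aff_dim_affine_hull aff_dim_UNIV affine_hull_convex_hull)
  hence "interior (convex hull V) = {}"
    using affine_hull_nonempty_interior by blast
  hence "negligible (convex hull V)"
    by (simp add: negligible_convex_interior)
  thus ?thesis
    by (simp add: measure_eq_0_null_sets negligible_iff_null_sets)
qed

lemma measure_tetrahedron:
  fixes A B C D :: "real ^ 3"
  assumes "card {A, B, C, D} = 4"
  shows "measure lebesgue (convex hull {A, B, C, D}) =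
    \<bar>det (\<chi> i j. (if j = 1 then B else if j = 2 then C else D) $ i - A $ i)\<bar> / 6"
proof -
  define f :: "3 \<Rightarrow> real ^ 3" where "f = (\<lambda>j. if j = 1 then B else if j = 2 then C else D)"
  have d: "A \<noteq> B" "A \<noteq> C" "A \<noteq> D" "B \<noteq> C" "B \<noteq> D" "C \<noteq> D"
    using assms by (auto simp: card_insert_if split: if_splits)
  have "bij_betw f UNIV ({A, B, C, D} - {A})"
    unfolding bij_betw_def
  proof
    show "inj f" using d by (auto simp: inj_on_def f_def forall_3)
    have "f ` UNIV = {f 1, f 2, f 3}" by (simp add: UNIV_3)
    thus "f ` UNIV = {A, B, C, D} - {A}" using d by (auto simp: f_def)
  qed
  hence "measure lborel (convex hull {A, B, C, D}) = \<bar>det (\<chi> i j. f j $ i - A $ i)\<bar> / fact CARD(3)"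
    by (rule content_simplex[rotated 3]) (use assms in simp_all)
  moreover have "measure lborel (convex hull {A, B, C, D}) = measure lebesgue (convex hull {A, B, C, D})"
    by (rule measure_completion[symmetric]) (simp add: borel_compact finite_imp_compact_convex_hull)
  moreover have "fact CARD(3) = (6 :: real)"
    by (simp add: fact_numeral)
  ultimately show ?thesis
    unfolding f_def by (simp only:)
qed

section \<open>Grid, apexes and the parametrised tetrahedra\<close>

definition lattice_point :: "nat \<Rightarrow> nat \<Rightarrow> real ^ 3" where
  "lattice_point x y = vector [real x, real y, 0]"

text \<open>The second coordinate \<open>-1\<close> places apexes below the grid, so that within each tetrahedron
  this coordinate orders, and thereby identifies, the vertices.\<close>

definition apex :: "nat \<Rightarrow> nat \<Rightarrow> real ^ 3" where
  "apex D k = vector [real k, -1, 6 / real D]"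

text \<open>The base has area \<open>D/2\<close> and the apex has height \<open>6/D\<close> for
  every \<open>k\<close>, so the volume is \<open>(1/3) (D/2) (6/D) = 1\<close>.\<close>

lemma unit_volume_over_lattice_triangle:
  fixes k x y x2 y2 x3 y3 D :: nat
  assumes "D > 0" "y < y3" "y3 < y2"
    and det: "(real x2 - real x) * (real y3 - real y)
      - (real x3 - real x) * (real y2 - real y) = real D"
  defines "V \<equiv> {apex D k, lattice_point x y, lattice_point x3 y3, lattice_point x2 y2}"
  shows "card V = 4" "measure lebesgue (convex hull V) = 1" "\<not> affine_dependent V"
proof -
  let ?a = "apex D k" and ?p = "lattice_point x y" and ?q = "lattice_point x3 y3"
    and ?r = "lattice_point x2 y2"
  have "?a $ 2 < ?p $ 2" "?p $ 2 < ?q $ 2" "?q $ 2 < ?r $ 2"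
    using assms(2,3) by (simp_all add: apex_def lattice_point_def)
  hence "distinct [?a, ?p, ?q, ?r]" by auto
  from distinct_card[OF this] show card: "card V = 4" by (simp add: V_def)
  \<comment> \<open>With a lattice vertex first, the edge vector to the apex is the last column of
    the determinant and the only one with a nonzero third entry.\<close>
  have V: "V = {?p, ?r, ?q, ?a}" unfolding V_def by auto
  have "measure lebesgue (convex hull V) =
      \<bar>((real x2 - real x) * (real y3 - real y) - (real x3 - real x) * (real y2 - real y))
        * (6 / real D)\<bar> / 6"
    using card unfolding V
    by (simp add: measure_tetrahedron det_3 apex_def lattice_point_def algebra_simps)
  thus vol: "measure lebesgue (convex hull V) = 1"
    unfolding det using \<open>D > 0\<close> by simp
  show "\<not> affine_dependent V"
    using measure_convex_hull_affine_dependent[of V] card vol by auto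
qed

text \<open>First lattice vertices lie in the middle third of the width, leaving room
  \<open>b\<close> for a shift to either side; the height leaves room \<open>a\<close>
  upwards.\<close>

definition base_points :: "nat \<Rightarrow> nat \<Rightarrow> nat \<Rightarrow> (real ^ 3) set" where
  "base_points a b c =
     (\<lambda>(x, y). lattice_point x y) ` ({..<3 * b} \<times> {..<2 * a}) \<union> apex (fact a) ` {..<c}"

lemma finite_base_points: "finite (base_points a b c)"
  by (simp add: base_points_def)

lemma card_base_points_le: "card (base_points a b c) \<le> 6 * a * b + c"
proof -
  have "card (base_points a b c) \<le> card ({..<3 * b} \<times> {..<2 * a}) + card {..<c}"
    unfolding base_points_def
    by (intro order_trans[OF card_Un_le] add_mono card_image_le) auto
  thus ?thesis by (simp add: algebra_simps)
qed

text \<open>The entries choose the apex, the position of the first lattice vertex, and the edge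
  vectors. Starting at \<open>v = 2\<close> makes a totative \<open>t\<close> strictly less than
  \<open>v\<close>; for \<open>v = 1\<close> it would equal \<open>v\<close>.\<close>

definition parameters where
  "parameters a b c = {..<c} \<times> {..<b} \<times> {..<a} \<times>
     (SIGMA v:{2..a}. totatives v \<times> {1..a div v} \<times> {1..b div v})"

text \<open>The truncated subtraction below is exact when \<open>a! \<le> b\<close>.\<close>

fun vertices :: "nat \<Rightarrow> nat \<Rightarrow> nat \<times> nat \<times> nat \<times> nat \<times> nat \<times> nat \<times> nat \<Rightarrow> (real ^ 3) set" where
  "vertices a b (k, x, y, v, t, d, m) =
     {apex (fact a) k, lattice_point (b + x) y,
      lattice_point (b + x + m * t - fact a div (d * v)) (y + d * t),
      lattice_point (b + x + m * v) (y + d * v)}"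

lemma card_parameters:
  "card (parameters a b c) = c * b * a * (\<Sum>v=2..a. totient v * (a div v) * (b div v))"
  by (simp add: parameters_def card_cartesian_product totient_def mult.assoc)

lemma vertices_parameters:
  assumes "p \<in> parameters a b c" "fact a \<le> b"
  shows "vertices a b p \<subseteq> base_points a b c" "card (vertices a b p) = 4"
    "measure lebesgue (convex hull (vertices a b p)) = 1" "\<not> affine_dependent (vertices a b p)"
proof -
  obtain k x y v t d m where p: "p = (k, x, y, v, t, d, m)"
    by (metis surj_pair)
  have par: "k < c" "x < b" "y < a" "2 \<le> v" "v \<le> a" "t \<in> totatives v" "1 \<le> d" "1 \<le> m"
    and "d \<le> a div v" "m \<le> b div v"
    using assms(1) by (auto simp: p parameters_def)
  have t: "0 < t" "t < v"
    using par totatives_less[of t v] by (auto intro: Nat.gr0I)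
  have dv: "d * v \<le> a" and mv: "m * v \<le> b"
    using \<open>d \<le> a div v\<close> \<open>m \<le> b div v\<close> \<open>2 \<le> v\<close> by (simp_all add: less_eq_div_iff_mult_less_eq)
  have dt: "d * t < d * v" and mt: "m * t < m * v" "0 < d * t"
    using t par by simp_all
  \<comment> \<open>A positive integer up to \<open>a\<close> is a factor of \<open>a!\<close>; this
    is why the factorial is taken as determinant.\<close>
  have "d * v dvd fact a"
    using dv mt(2) dt by (intro dvd_fact) linarith+
  then obtain e where e: "fact a = d * v * e" by (elim dvdE)
  have "e \<le> fact a" using e mt(2) dt by (cases "d * v") auto
  hence "e \<le> b" using assms(2) by simp
  have e': "fact a div (d * v) = e" using e mt(2) dt by simp
  show "vertices a b p \<subseteq> base_points a b c"
  proof -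
    have base: "lattice_point i j \<in> base_points a b c" if "i < 3 * b" "j < 2 * a" for i j
      unfolding base_points_def
      by (intro UnI1 image_eqI[where x = "(i, j)"]) (use that in simp_all)
    have "apex (fact a) k \<in> base_points a b c"
      using par(1) by (simp add: base_points_def)
    moreover have "b + x + m * t - fact a div (d * v) < 3 * b"
      using par(2) mv mt(1) by (intro le_less_trans[OF diff_le_self]) linarith
    moreover have "b + x < 3 * b" "b + x + m * v < 3 * b"
        "y < 2 * a" "y + d * t < 2 * a" "y + d * v < 2 * a"
      using par(2,3) dv mv dt by linarith+
    ultimately show ?thesis
      unfolding p vertices.simps insert_subset using base by blast
  qed
  \<comment> \<open>The products \<open>m * v * d * t\<close> cancel, leaving
    \<open>e * d * v = a!\<close>.\<close>
  have det: "(real (b + x + m * v) - real (b + x)) * (real (y + d * t) - real y)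
      - (real (b + x + m * t - fact a div (d * v)) - real (b + x)) * (real (y + d * v) - real y)
      = real (fact a)"
    unfolding e' e using \<open>e \<le> b\<close> by (simp add: of_nat_diff algebra_simps)
  show "card (vertices a b p) = 4" "measure lebesgue (convex hull (vertices a b p)) = 1"
    "\<not> affine_dependent (vertices a b p)"
    using unit_volume_over_lattice_triangle[OF _ _ _ det, of k] dt mt by (simp_all add: p)
qed

text \<open>The second coordinate increases strictly from the apex through the three lattice
  vertices in the listed order, so equal sets agree vertex by vertex.\<close>

lemma inj_on_vertices: "inj_on (vertices a b) (parameters a b c)"
proof (rule inj_onI)
  fix p p' assume pp: "p \<in> parameters a b c" "p' \<in> parameters a b c"
    and eq: "vertices a b p = vertices a b p'"
  obtain k x y v t d m where p: "p = (k, x, y, v, t, d, m)"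
    by (metis surj_pair)
  obtain k' x' y' v' t' d' m' where p': "p' = (k', x', y', v', t', d', m')"
    by (metis surj_pair)
  have par: "0 < t" "t < v" "coprime t v" "d > 0" "v > 0"
    using pp(1) totatives_less[of t v] by (auto simp: p parameters_def in_totatives_iff)
  have par': "0 < t'" "t' < v'" "coprime t' v'" "d' > 0" "v' > 0"
    using pp(2) totatives_less[of t' v'] by (auto simp: p' parameters_def in_totatives_iff)
  note * = insert4_eq_imp_eq[OF eq[unfolded p p' vertices.simps], of "\<lambda>z. z $ 2"]
  have 1: "apex (fact a) k = apex (fact a) k'" "lattice_point (b + x) y = lattice_point (b + x') y'"
    "lattice_point (b + x + m * t - fact a div (d * v)) (y + d * t)
      = lattice_point (b + x' + m' * t' - fact a div (d' * v')) (y' + d' * t')"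
    "lattice_point (b + x + m * v) (y + d * v) = lattice_point (b + x' + m' * v') (y' + d' * v')"
    by (rule *; use par par' in \<open>simp add: apex_def lattice_point_def\<close>)+
  have inj: "x1 = x2 \<and> y1 = y2" if "lattice_point x1 y1 = lattice_point x2 y2" for x1 y1 x2 y2
    using that unfolding lattice_point_def by (metis of_nat_eq_iff vector_3(1,2))
  have "k = k'"
    using 1(1) unfolding apex_def by (metis of_nat_eq_iff vector_3(1))
  moreover have xy: "x = x'" "y = y'" using inj[OF 1(2)] by auto
  moreover have dt: "d * t = d' * t'" using inj[OF 1(3)] xy by auto
  moreover have dv: "d * v = d' * v'" and mv: "m * v = m' * v'" using inj[OF 1(4)] xy by auto
  \<comment> \<open>Coprimality of \<open>t\<close> and \<open>v\<close> recovers \<open>d\<close>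
    as the gcd of \<open>d * t\<close> and \<open>d * v\<close>; then \<open>t\<close>,
    \<open>v\<close> and \<open>m\<close> follow by cancellation.\<close>
  moreover have "d = d'"
  proof -
    have "gcd (d * t) (d * v) = d" "gcd (d' * t') (d' * v') = d'"
      using par par' by (simp_all add: gcd_mult_distrib_nat[symmetric])
    thus ?thesis using dt dv by simp
  qed
  ultimately show "p = p'" using par par' by (auto simp: p p')
qed

section \<open>Lower bound for the count\<close>

lemma card_unit_volume_tetrahedra_ge:
  assumes "finite S" "base_points a b c \<subseteq> S" "fact a \<le> b"
  shows "card (parameters a b c) \<le> card (unit_volume_tetrahedra S)"
proof (rule card_inj_on_le)
  show "inj_on (\<lambda>p. convex hull (vertices a b p)) (parameters a b c)"
    using convex_hull_eq_imp_eq_affine_independent vertices_parameters(4)[OF _ assms(3)]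
      inj_on_vertices[of a b c] by (smt (verit) inj_on_def)
  show "(\<lambda>p. convex hull (vertices a b p)) ` parameters a b c \<subseteq> unit_volume_tetrahedra S"
    using vertices_parameters[OF _ assms(3)] assms(2)
    by (fastforce simp: unit_volume_tetrahedra_def tetrahedra_def)
  \<comment> \<open>Finiteness matters because \<open>card\<close> of an infinite set is 0.\<close>
  have "unit_volume_tetrahedra S \<subseteq> (\<lambda>V. convex hull V) ` Pow S"
    by (auto simp: unit_volume_tetrahedra_def tetrahedra_def)
  thus "finite (unit_volume_tetrahedra S)"
    using assms(1) finite_subset by blast
qed

lemma card_parameters_ge:
  assumes "fact a \<le> b"
  shows "real (card (parameters a b c))
    \<ge> real c * (real a * real b) ^ 2 * (ln (real a + 1) / 2 - 1) / 4"
proof (cases "a \<ge> 1")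
  case True
  have "a \<le> b" using assms fact_ge_self[of a] by (rule order_trans[rotated])
  \<comment> \<open>The subtracted 1 is the omitted term for \<open>v = 1\<close>.\<close>
  have "(ln (real a + 1) / 2 - 1) \<le> (\<Sum>v=2..a. real (totient v) / real v ^ 2)"
    using sum_totient_over_square_ge[of a] True
    by (simp add: sum.atLeast_Suc_atMost numeral_2_eq_2)
  hence "real a * real b * (ln (real a + 1) / 2 - 1) / 4
      \<le> real a * real b * (\<Sum>v=2..a. real (totient v) / real v ^ 2) / 4"
    by (intro divide_right_mono mult_left_mono) auto
  also have "\<dots> = (\<Sum>v=2..a. real (totient v) * (real a / (2 * real v)) * (real b / (2 * real v)))"
    by (simp add: sum_distrib_left sum_divide_distrib power2_eq_square mult_ac)
  also have "\<dots> \<le> (\<Sum>v=2..a. real (totient v) * real (a div v) * real (b div v))"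
    using \<open>a \<le> b\<close> by (intro sum_mono mult_mono half_le_of_nat_div) auto
  also have "\<dots> = real (\<Sum>v=2..a. totient v * (a div v) * (b div v))"
    by simp
  finally have "real c * real b * real a * (real a * real b * (ln (real a + 1) / 2 - 1) / 4)
      \<le> real c * real b * real a * real (\<Sum>v=2..a. totient v * (a div v) * (b div v))"
    by (intro mult_left_mono) auto
  thus ?thesis
    unfolding card_parameters of_nat_mult by (simp add: power2_eq_square mult_ac)
qed (simp add: not_le)

section \<open>Choice of the scales for given n\<close>

lemma exists_superset_card:
  assumes "infinite (UNIV :: 'a set)" "finite (A :: 'a set)" "card A \<le> n"
  shows "\<exists>B. A \<subseteq> B \<and> finite B \<and> card B = n"
proof -
  obtain C where "finite C" "card C = n - card A" "A \<inter> C = {}"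
    using finite_arbitrarily_large_disj[OF assms(1,2)] by blast
  thus ?thesis using assms by (intro exI[of _ "A \<union> C"]) (auto simp: card_Un_disjoint)
qed

text \<open>With \<open>s = sqrt (ln n)\<close>, \<open>a! <= s powr s = exp (s ln s)\<close>, which
  is \<open>n\<close> to a power tending to 0 since \<open>s^2 = ln n\<close>. Hence
  \<open>a!\<close> fits below \<open>b\<close>, which is about \<open>n/(12 a)\<close>.\<close>

lemma scale_bounds:
  fixes n :: nat
  defines "a \<equiv> nat \<lfloor>sqrt (ln (real n))\<rfloor>"
  defines "b \<equiv> n div (12 * a)"
  assumes n: "sqrt (ln n) \<ge> 1" "24 * sqrt (ln n) * sqrt (ln n) powr sqrt (ln n) \<le> real n"
  shows "sqrt (ln n) \<le> real a + 1" "fact a \<le> b" "real a * real b \<ge> real n / 24"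
proof -
  define s where "s = sqrt (ln (real n))"
  have a: "real a \<le> s" "s \<le> real a + 1" "1 \<le> a"
    using n(1) unfolding a_def s_def by linarith+
  thus "sqrt (ln n) \<le> real a + 1" by (simp add: s_def)
  have "s > 0" using a by linarith
  have "real a * real (fact a) * 24 \<le> s * (s powr s) * 24"
  proof (intro mult_right_mono mult_mono)
    have "real (fact a) \<le> real a ^ a"
      using fact_le_power[of a] by simp
    also have "\<dots> \<le> s ^ a" using a by (intro power_mono) auto
    also have "\<dots> = s powr real a" using \<open>s > 0\<close> by (simp add: powr_realpow)
    also have "\<dots> \<le> s powr s" using a n(1) by (intro powr_mono) (auto simp: s_def)
    finally show "real (fact a) \<le> s powr s" .
  qed (use a \<open>s > 0\<close> in auto)
  also have "\<dots> \<le> real n" using n(2) by (simp add: s_def mult_ac)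
  finally have *: "24 * (real a * real (fact a)) \<le> real n" by (simp add: mult_ac)
  hence "real (24 * (a * fact a)) \<le> real n" by simp
  hence **: "24 * (a * fact a) \<le> n" by (simp only: of_nat_le_iff)
  have "fact a * (12 * a) \<le> 24 * (a * fact a)" by simp
  hence "fact a * (12 * a) \<le> n" using ** by (rule order_trans)
  thus "fact a \<le> b"
    unfolding b_def using a(3) by (simp add: less_eq_div_iff_mult_less_eq)
  have "a * 1 \<le> a * fact a" by (intro mult_le_mono2 fact_ge_1)
  hence "12 * a \<le> n" using ** by linarith
  from half_le_of_nat_div[OF _ this] a(3)
  have "real n / (24 * real a) \<le> real b" by (simp add: b_def)
  thus "real a * real b \<ge> real n / 24" using a(3) by (simp add: field_simps)
qed

theorem mainTheorem4:
  shows "\<exists>P :: nat \<Rightarrow> (real ^ 3) set.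
           (\<forall>n. finite (P n) \<and> card (P n) = n) \<and>
           (\<lambda>n. real (card (unit_volume_tetrahedra (P n))))
             \<in> \<Omega>(\<lambda>n. real n ^ 3 * ln (ln (real n)))"
proof -
  define a :: "nat \<Rightarrow> nat" where "a = (\<lambda>n. nat \<lfloor>sqrt (ln (real n))\<rfloor>)"
  define b :: "nat \<Rightarrow> nat" where "b = (\<lambda>n. n div (12 * a n))"
  have inf: "infinite (UNIV :: (real ^ 3) set)"
    by (rule infinite_UNIV_char_0)
  have "\<exists>S. base_points (a n) (b n) (n div 2) \<subseteq> S \<and> finite S \<and> card S = n" for n
  proof (rule exists_superset_card[OF inf finite_base_points])
    \<comment> \<open>The grid takes at most \<open>n/2\<close> points, leaving
      \<open>n div 2\<close> for apexes. When \<open>a n = 0\<close>, division by zero gives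
      \<open>b n = 0\<close> and the bound still holds.\<close>
    have "12 * a n * b n \<le> n" by (simp add: b_def)
    thus "card (base_points (a n) (b n) (n div 2)) \<le> n"
      using card_base_points_le[of "a n" "b n" "n div 2"] by linarith
  qed
  then obtain P where P: "\<And>n. base_points (a n) (b n) (n div 2) \<subseteq> P n"
      "\<And>n. finite (P n)" "\<And>n. card (P n) = n"
    by metis
  \<comment> \<open>\<open>n >= 6\<close> gives \<open>n div 2 >= n/3\<close>;
    \<open>ln (ln n) >= 8\<close> lets \<open>ln (ln n) / 4 - 1\<close> be replaced by
    \<open>ln (ln n) / 8\<close>.\<close>
  have "eventually (\<lambda>n::nat. n \<ge> 6 \<and> sqrt (ln n) \<ge> 1 \<and>
      24 * sqrt (ln n) * sqrt (ln n) powr sqrt (ln n) \<le> real n \<and> ln (ln n) \<ge> 8) at_top"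
    by (intro eventually_conj; real_asymp)
  hence "eventually (\<lambda>n. real n ^ 3 * ln (ln (real n))
      \<le> 55296 * real (card (unit_volume_tetrahedra (P n)))) at_top"
  proof eventually_elim
    case (elim n)
    have ab: "sqrt (ln n) \<le> real (a n) + 1" "fact (a n) \<le> b n" "real n / 24 \<le> real (a n) * real (b n)"
      using scale_bounds[of n] elim unfolding a_def b_def by blast+
    have "ln (sqrt (ln n)) \<le> ln (real (a n) + 1)"
      using ab(1) elim by (subst ln_le_cancel_iff) linarith+
    hence L: "ln (ln n) / 8 \<le> ln (real (a n) + 1) / 2 - 1"
      using elim by (simp add: ln_sqrt)
    \<comment> \<open>\<open>55296 = 3 * 24^2 * 8 * 4\<close>: the losses from the number of apexes,
      the grid size, the logarithm and the two integer divisions.\<close>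
    have "real n ^ 3 * ln (ln n) / 55296 = (real n / 3) * (real n / 24) ^ 2 * (ln (ln n) / 8) / 4"
      by (simp add: power2_eq_square power3_eq_cube)
    also have "\<dots> \<le> real (n div 2) * (real (a n) * real (b n)) ^ 2 * (ln (real (a n) + 1) / 2 - 1) / 4"
      using ab L elim by (intro divide_right_mono mult_mono power_mono) auto
    also have "\<dots> \<le> real (card (parameters (a n) (b n) (n div 2)))"
      by (rule card_parameters_ge[OF ab(2)])
    also have "\<dots> \<le> real (card (unit_volume_tetrahedra (P n)))"
      using card_unit_volume_tetrahedra_ge[OF P(2,1) ab(2)] by simp
    finally show ?case by simp
  qed
  hence "(\<lambda>n. real (card (unit_volume_tetrahedra (P n)))) \<in> \<Omega>(\<lambda>n. real n ^ 3 * ln (ln (real n)))"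
  proof (intro landau_omega.bigI[of "1 / 55296"])
    assume ev: "eventually (\<lambda>n. real n ^ 3 * ln (ln (real n))
      \<le> 55296 * real (card (unit_volume_tetrahedra (P n)))) at_top"
    have "eventually (\<lambda>n::nat. ln (ln (real n)) \<ge> 0) at_top" by real_asymp
    with ev show "eventually (\<lambda>n. norm (real (card (unit_volume_tetrahedra (P n))))
      \<ge> 1 / 55296 * norm (real n ^ 3 * ln (ln (real n)))) at_top"
      by eventually_elim (simp add: abs_mult)
  qed simp
  with P show ?thesis by blast
qed

end
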